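(* Let $R$ be a CG-ring, and let $S,S'\subset R$ be distinct subsets, $S\neq\emptyset$, both contained in one and the same pure orbit (under multiplication) of some subgroup of $R^\times$. Then (1) there exists $\chi\in\widehat R^\times$ such that $\chi(S)\ne\chi(S')$; (2) given $\chi\in\widehat R^\times$ there exists $r\in R^\times$ such that $\chi(rS)\ne 0$.
   Context: All rings are finite, commutative, with identity. For a ring $R$, $R^+$ is the additive group, $R^\times$ the group of units (acting on $R$ by multiplication). For a prime $p$ dividing $|R|$, $R_p$ is the $p$-component of $R$ (the subring whose additive group is the Sylow $p$-subgroup of $R^+$), so $R=\prod_pR_p$. $R$ is a CG-ring if every $R_p$ is a Galois ring, i.e. a local ring with radical $pR_p$. A non-empty set $X\subset R$ is pure if the only ideal $I$ of $R$ with $X+I=X$ is $I=0$. Let $c$ be the characteristic of $R$ and $c_p$ that of $R_p$. Fix for each $p$ a complex character $\chi_p$ of $R_p^+$ whose image contains a primitive $c_p$th root of unity, and let $\chi_0=\prod_p\chi_p$, a character of $R^+$. The dual ring $\widehat R$ is the group of all complex irreducible characters of $R^+$; every such character has the form $\chi_0^{(r)}:x\mapsto\chi_0(rx)$ for a unique $r\in R$, and the ring multiplication is $\chi_0^{(r)}\chi_0^{(s)}=\chi_0^{(rs)}$. Its set of units is $\widehat R^\times=\{\chi_0^{(r)}: r\in R^\times\}$; this set does not depend on the choice of $\chi_0$ (it consists of the characters of $R^+$ of order exactly $c$). For a character $\chi$ of $R^+$ and $S\subset R$, $\chi(S)=\sum_{s\in S}\chi(s)$ (so $\chi(\emptyset)=0$).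 *)

theory Defs
  imports Complex_Main "HOL-Algebra.Algebra"
begin

definition finite_cring :: "('a, 'm) ring_scheme \<Rightarrow> bool" where
  "finite_cring R \<longleftrightarrow> cring R \<and> finite (carrier R)"

text \<open>The characteristic is meant for finite rings, where the least number exists; it is 1 for
  the zero ring.\<close>

definition characteristic :: "('a, 'm) ring_scheme \<Rightarrow> nat" where
  "characteristic R = (LEAST n::nat. n > 0 \<and> add_pow R n \<one>\<^bsub>R\<^esub> = \<zero>\<^bsub>R\<^esub>)"

text \<open>The \<open>p\<close>-component has as carrier the Sylow \<open>p\<close>-subgroup of the additive group. It is a ring
  in its own right, but its identity is an idempotent of \<open>R\<close> that in general differs from the
  identity of \<open>R\<close>.\<close>

definition p_part :: "('a, 'm) ring_scheme \<Rightarrow> nat \<Rightarrow> 'a set" where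
  "p_part R p = {x \<in> carrier R. \<exists>k::nat. add_pow R (p ^ k) x = \<zero>\<^bsub>R\<^esub>}"

definition p_component :: "('a, 'm) ring_scheme \<Rightarrow> nat \<Rightarrow> ('a, 'm) ring_scheme" where
  "p_component R p = R\<lparr>carrier := p_part R p,
     one := (THE e. e \<in> p_part R p \<and> (\<forall>x\<in>p_part R p. e \<otimes>\<^bsub>R\<^esub> x = x))\<rparr>"

definition local_cring :: "('a, 'm) ring_scheme \<Rightarrow> bool" where
  "local_cring A \<longleftrightarrow> cring A \<and> (\<exists>!M. maximalideal M A)"

definition radical :: "('a, 'm) ring_scheme \<Rightarrow> 'a set" where
  "radical A = carrier A \<inter> \<Inter> {M. maximalideal M A}"

definition galois_ring :: "nat \<Rightarrow> ('a, 'm) ring_scheme \<Rightarrow> bool" where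
  "galois_ring p A \<longleftrightarrow> local_cring A \<and> finite (carrier A) \<and>
     radical A = (\<lambda>x. add_pow A p x) ` carrier A"

definition CG_ring :: "('a, 'm) ring_scheme \<Rightarrow> bool" where
  "CG_ring R \<longleftrightarrow> finite_cring R \<and>
     (\<forall>p\<in>prime_factors (order R). galois_ring p (p_component R p))"

definition pure :: "('a, 'm) ring_scheme \<Rightarrow> 'a set \<Rightarrow> bool" where
  "pure R Y \<longleftrightarrow> Y \<noteq> {} \<and> Y \<subseteq> carrier R \<and>
     (\<forall>I. ideal I R \<longrightarrow> Y <+>\<^bsub>R\<^esub> I = Y \<longrightarrow> I = {\<zero>\<^bsub>R\<^esub>})"

definition mult_orbit :: "('a, 'm) ring_scheme \<Rightarrow> 'a set \<Rightarrow> 'a \<Rightarrow> 'a set" where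
  "mult_orbit R K x = orbit ((units_of R)\<lparr>carrier := K\<rparr>) (\<lambda>k y. k \<otimes>\<^bsub>R\<^esub> y) x"

text \<open>The irreducible complex characters of an abelian group are its homomorphisms to the
  multiplicative group of the complex numbers. They are made extensional so that characters that
  agree on the group are equal as functions.\<close>

definition complex_mult_group :: "complex monoid" where
  "complex_mult_group = \<lparr>carrier = - {0}, monoid.mult = (*), one = 1\<rparr>"

definition characters :: "('a, 'm) monoid_scheme \<Rightarrow> ('a \<Rightarrow> complex) set" where
  "characters G = hom G complex_mult_group \<inter> extensional (carrier G)"

definition primitive_root_of_unity :: "nat \<Rightarrow> complex \<Rightarrow> bool" where
  "primitive_root_of_unity n z \<longleftrightarrow> z ^ n = 1 \<and> (\<forall>k. 0 < k \<and> k < n \<longrightarrow> z ^ k \<noteq> 1)"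

definition admissible_family :: "('a, 'm) ring_scheme \<Rightarrow> (nat \<Rightarrow> 'a \<Rightarrow> complex) \<Rightarrow> bool" where
  "admissible_family R \<phi> \<longleftrightarrow> (\<forall>p\<in>prime_factors (order R).
     \<phi> p \<in> characters (add_monoid (p_component R p)) \<and>
     (\<exists>z \<in> \<phi> p ` carrier (p_component R p).
        primitive_root_of_unity (characteristic (p_component R p)) z))"

text \<open>The projection of \<open>R\<close> onto its \<open>p\<close>-component is multiplication by the identity of the
  \<open>p\<close>-component, so this is the product of the characters \<open>\<phi> p\<close> on the direct sum.\<close>

definition product_character ::
    "('a, 'm) ring_scheme \<Rightarrow> (nat \<Rightarrow> 'a \<Rightarrow> complex) \<Rightarrow> 'a \<Rightarrow> complex" where
  "product_character R \<phi> = (\<lambda>x\<in>carrier R.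
     \<Prod>p\<in>prime_factors (order R). \<phi> p (\<one>\<^bsub>p_component R p\<^esub> \<otimes>\<^bsub>R\<^esub> x))"

definition twist :: "('a, 'm) ring_scheme \<Rightarrow> ('a \<Rightarrow> complex) \<Rightarrow> 'a \<Rightarrow> 'a \<Rightarrow> complex" where
  "twist R \<chi>\<^sub>0 r = (\<lambda>x\<in>carrier R. \<chi>\<^sub>0 (r \<otimes>\<^bsub>R\<^esub> x))"

text \<open>The dual ring: all characters of the additive group, with pointwise product as addition.
  If \<open>\<chi>\<^sub>0\<close> is the product character of an admissible family of a CG-ring, then \<open>twist R \<chi>\<^sub>0\<close> is a
  bijection from \<open>R\<close> onto the characters, and its inverse is used to multiply them.\<close>

definition dual_ring :: "('a, 'm) ring_scheme \<Rightarrow> ('a \<Rightarrow> complex) \<Rightarrow> ('a \<Rightarrow> complex) ring" where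
  "dual_ring R \<chi>\<^sub>0 = \<lparr>
     carrier = characters (add_monoid R),
     monoid.mult = (\<lambda>\<chi> \<psi>. twist R \<chi>\<^sub>0 (the_inv_into (carrier R) (twist R \<chi>\<^sub>0) \<chi> \<otimes>\<^bsub>R\<^esub>
                                the_inv_into (carrier R) (twist R \<chi>\<^sub>0) \<psi>)),
     one = twist R \<chi>\<^sub>0 \<one>\<^bsub>R\<^esub>,
     ring.zero = twist R \<chi>\<^sub>0 \<zero>\<^bsub>R\<^esub>,
     ring.add = (\<lambda>\<chi> \<psi>. \<lambda>x\<in>carrier R. \<chi> x * \<psi> x)\<rparr>"

definition char_sum :: "('a \<Rightarrow> complex) \<Rightarrow> 'a set \<Rightarrow> complex" where
  "char_sum \<chi> S = (\<Sum>s\<in>S. \<chi> s)"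

end

theory Submission
  imports Defs "HOL-Number_Theory.Cong"
begin

text \<open>The character \<open>\<chi>\<^sub>0\<close> is generating: its kernel contains no non-zero ideal. Hence \<open>twist R \<chi>\<^sub>0\<close> is
  a bijection from \<open>R\<close> onto the characters that matches units with units, and both claims say that
  a function \<open>f \<noteq> 0\<close> supported on a pure orbit \<open>X\<close> (a difference of two indicators, or an indicator)
  has a non-zero Fourier coefficient at some unit.

  Let \<open>I\<^sub>p\<close> be the set of elements killed by \<open>p\<close>. An element \<open>r\<close> that is not a unit satisfies
  \<open>r I\<^sub>p = 0\<close> for some \<open>p\<close>. So if all coefficients of \<open>f\<close> at units vanish, Fourier inversion shows that
  \<open>f\<close> is killed by the product over \<open>p\<close> of the differences along any \<open>a\<^sub>p \<in> I\<^sub>p\<close>: for each \<open>y\<close> the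
  alternating sum of the values \<open>f (y + \<Sum>\<^sub>p\<^sub>\<in>\<^sub>Q a\<^sub>p)\<close> over all sets \<open>Q\<close> of primes is \<open>0\<close>. If \<open>f y \<noteq> 0\<close>,
  this is contradicted by a choice of the \<open>a\<^sub>p\<close> for which \<open>y + \<Sum>\<^sub>p\<^sub>\<in>\<^sub>Q a\<^sub>p \<notin> X\<close> whenever \<open>Q \<noteq> {}\<close>.

  Purity provides \<open>a\<^sub>p\<close> with \<open>y + a\<^sub>p \<notin> X\<close>. To treat all \<open>Q\<close> at once, suppose that
  \<open>k y = y + \<Sum>\<^sub>p\<^sub>\<in>\<^sub>Q a\<^sub>p\<close> with \<open>k \<in> K\<close>. If no component of \<open>y\<close> at a prime of \<open>Q\<close> lies in \<open>I\<^sub>p\<close>, then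
  \<open>k - 1\<close> kills the \<open>a\<^sub>p\<close>, so that \<open>k\<^sup>m y = y + m \<Sum>\<^sub>p\<^sub>\<in>\<^sub>Q a\<^sub>p\<close>, and the Chinese remainder theorem gives
  an \<open>m\<close> that leaves a single \<open>a\<^sub>p\<close>. If the component of \<open>y\<close> lies in \<open>I\<^sub>p\<close>, choose \<open>a\<^sub>p\<close> such that exactly
  one of the components of \<open>y\<close> and \<open>y + a\<^sub>p\<close> is \<open>0\<close>; multiplication by a unit cannot change this.\<close>

subsection \<open>Characters and Fourier inversion\<close>

context ring
begin

lemma character_add:
  assumes "\<chi> \<in> characters (add_monoid R)" "x \<in> carrier R" "y \<in> carrier R"
  shows "\<chi> (x \<oplus> y) = \<chi> x * \<chi> y"
  using assms by (auto simp: characters_def hom_def complex_mult_group_def)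

lemma character_nonzero:
  assumes "\<chi> \<in> characters (add_monoid R)" "x \<in> carrier R"
  shows "\<chi> x \<noteq> 0"
  using assms by (auto simp: characters_def hom_def complex_mult_group_def)

lemma charactersI:
  assumes "\<And>x. x \<in> carrier R \<Longrightarrow> \<chi> x \<noteq> 0"
    and "\<And>x y. x \<in> carrier R \<Longrightarrow> y \<in> carrier R \<Longrightarrow> \<chi> (x \<oplus> y) = \<chi> x * \<chi> y"
    and "\<chi> \<in> extensional (carrier R)"
  shows "\<chi> \<in> characters (add_monoid R)"
  using assms by (auto simp: characters_def hom_def complex_mult_group_def)

lemma character_zero:
  assumes "\<chi> \<in> characters (add_monoid R)"
  shows "\<chi> \<zero> = 1"
  using character_add[OF assms, of \<zero> \<zero>] character_nonzero[OF assms, of \<zero>] by simp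

lemma character_minus:
  assumes "\<chi> \<in> characters (add_monoid R)" "x \<in> carrier R"
  shows "\<chi> (\<ominus> x) = inverse (\<chi> x)"
proof -
  have "\<chi> (\<ominus> x) * \<chi> x = 1"
    using character_add[OF assms(1), of "\<ominus> x" x] assms by (simp add: l_neg character_zero)
  then show ?thesis
    using character_nonzero[OF assms] by (simp add: field_simps)
qed

lemma character_finsum:
  assumes "\<chi> \<in> characters (add_monoid R)" "finite Q" "a \<in> Q \<rightarrow> carrier R"
  shows "\<chi> (\<Oplus>p\<in>Q. a p) = (\<Prod>p\<in>Q. \<chi> (a p))"
  using assms(2,3)
  by (induction Q rule: finite_induct)
     (simp_all add: character_zero[OF assms(1)] character_add[OF assms(1)] Pi_def)

lemma character_add_pow:
  assumes "\<chi> \<in> characters (add_monoid R)" "x \<in> carrier R"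
  shows "\<chi> ([(n::nat)] \<cdot> x) = \<chi> x ^ n"
  using assms(2)
  by (induction n) (simp_all add: character_zero[OF assms(1)] character_add[OF assms(1)])

lemma add_pow_cong:
  fixes m n q :: nat
  assumes "x \<in> carrier R" "add_pow R q x = \<zero>" "[m = n] (mod q)"
  shows "add_pow R m x = add_pow R n x"
proof -
  have "add_pow R m x = add_pow R (m mod q) x" for m :: nat
  proof -
    have "add_pow R m x = add_pow R (q * (m div q) + m mod q) x"
      by simp
    also have "\<dots> = add_pow R (m div q) (add_pow R q x) \<oplus> add_pow R (m mod q) x"
      using add.nat_pow_mult[OF assms(1), of "q * (m div q)" "m mod q"]
        add.nat_pow_pow[OF assms(1), of "m div q" q] by simp
    finally show ?thesis
      using assms(1,2) by simp
  qed
  then show ?thesis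
    using assms(3) by (metis cong_def)
qed

lemma sum_translate:
  assumes "a \<in> carrier R"
  shows "(\<Sum>x\<in>carrier R. f (a \<oplus> x)) = (\<Sum>x\<in>carrier R. f x)"
proof (rule sum.reindex_bij_betw)
  show "bij_betw (\<lambda>x. a \<oplus> x) (carrier R) (carrier R)"
    by (rule bij_betwI[where g = "\<lambda>x. \<ominus> a \<oplus> x"])
       (use assms in \<open>auto simp: a_assoc[symmetric] r_neg l_neg\<close>)
qed

text \<open>Translation by \<open>a\<close> permutes the carrier and multiplies the sum by
  \<open>\<chi> a\<close>, which is not 1.\<close>

lemma sum_nontrivial_character:
  assumes "\<chi> \<in> characters (add_monoid R)" "a \<in> carrier R" "\<chi> a \<noteq> 1"
  shows "(\<Sum>x\<in>carrier R. \<chi> x) = 0"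
proof -
  have "(\<Sum>x\<in>carrier R. \<chi> x) = (\<Sum>x\<in>carrier R. \<chi> (a \<oplus> x))"
    using sum_translate[OF assms(2), of \<chi>] by simp
  also have "\<dots> = \<chi> a * (\<Sum>x\<in>carrier R. \<chi> x)"
    using assms by (simp add: character_add sum_distrib_left)
  finally show ?thesis
    using assms(3) by simp
qed

lemma twist_in_characters:
  assumes "\<chi> \<in> characters (add_monoid R)" "r \<in> carrier R"
  shows "twist R \<chi> r \<in> characters (add_monoid R)"
  by (rule charactersI)
     (use assms in \<open>auto simp: twist_def r_distr character_add character_nonzero\<close>)

lemma twist_apply: "x \<in> carrier R \<Longrightarrow> twist R \<chi> r x = \<chi> (r \<otimes> x)"
  by (simp add: twist_def)

end

section \<open>Generating characters and the dual ring\<close>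

text \<open>The condition \<open>generating\<close> speaks of principal ideals only, which suffices
  because every non-zero ideal contains a non-zero principal one.\<close>

locale generating_character = cring R for R (structure) +
  fixes \<chi> :: "'a \<Rightarrow> complex"
  assumes finite_carrier: "finite (carrier R)"
    and character: "\<chi> \<in> characters (add_monoid R)"
    and generating: "\<lbrakk>x \<in> carrier R; \<And>r. r \<in> carrier R \<Longrightarrow> \<chi> (r \<otimes> x) = 1\<rbrakk> \<Longrightarrow> x = \<zero>"
begin

text \<open>For \<open>x \<noteq> \<zero>\<close> the property \<open>generating\<close> makes the
  twist by \<open>x\<close> a non-trivial character, whose values sum to 0.\<close>

lemma sum_twist:
  assumes "x \<in> carrier R"
  shows "(\<Sum>r\<in>carrier R. \<chi> (r \<otimes> x)) = (if x = \<zero> then of_nat (card (carrier R)) else 0)"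
proof (cases "x = \<zero>")
  case True
  then show ?thesis
    by (simp add: character_zero[OF character])
next
  case False
  then obtain r where r: "r \<in> carrier R" "\<chi> (r \<otimes> x) \<noteq> 1"
    using generating assms by blast
  have "(\<Sum>r\<in>carrier R. \<chi> (r \<otimes> x)) = (\<Sum>r\<in>carrier R. twist R \<chi> x r)"
    by (rule sum.cong) (use assms in \<open>auto simp: twist_apply m_comm\<close>)
  also have "\<dots> = 0"
    by (rule sum_nontrivial_character[of _ r])
       (use assms r character in \<open>auto simp: twist_in_characters twist_apply m_comm\<close>)
  finally show ?thesis
    using False by simp
qed

lemma inj_on_twist: "inj_on (twist R \<chi>) (carrier R)"
proof (rule inj_onI)
  fix r s assume rs: "r \<in> carrier R" "s \<in> carrier R" "twist R \<chi> r = twist R \<chi> s"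
  have "r \<ominus> s = \<zero>"
  proof (rule generating)
    show "\<chi> (x \<otimes> (r \<ominus> s)) = 1" if x: "x \<in> carrier R" for x
    proof -
      have "x \<otimes> (r \<ominus> s) = r \<otimes> x \<oplus> \<ominus> (s \<otimes> x)"
        using rs x by algebra
      then have "\<chi> (x \<otimes> (r \<ominus> s)) = \<chi> (r \<otimes> x) * inverse (\<chi> (s \<otimes> x))"
        using rs x by (simp add: character_add[OF character] character_minus[OF character])
      also have "\<chi> (r \<otimes> x) = \<chi> (s \<otimes> x)"
        using x rs(3) by (metis twist_apply)
      finally show ?thesis
        using rs x character_nonzero[OF character, of "s \<otimes> x"] by simp
    qed
  qed (use rs in simp)
  then show "r = s"
    using rs by simp
qed

text \<open>Surjectivity comes from orthogonality. A character \<psi> outside the image is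
  orthogonal to every twist, so the sum of \<open>\<psi> x * \<chi> (r \<otimes> x)\<close> over all
  \<open>x\<close> and \<open>r\<close> is 0. Summed over \<open>r\<close> first, only
  \<open>x = \<zero>\<close> survives and the value is the size of the ring.\<close>

lemma twist_image: "twist R \<chi> ` carrier R = characters (add_monoid R)"
proof (intro equalityI subsetI)
  fix \<psi> assume \<psi>: "\<psi> \<in> characters (add_monoid R)"
  show "\<psi> \<in> twist R \<chi> ` carrier R"
  proof (rule ccontr)
    assume neg: "\<psi> \<notin> twist R \<chi> ` carrier R"
    have orth: "(\<Sum>x\<in>carrier R. \<psi> x * \<chi> (r \<otimes> x)) = 0" if r: "r \<in> carrier R" for r
    proof -
      let ?\<theta> = "\<lambda>x\<in>carrier R. \<psi> x * \<chi> (r \<otimes> x)"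
      have \<theta>: "?\<theta> \<in> characters (add_monoid R)"
        by (rule charactersI) (use \<psi> r character in
            \<open>auto simp: character_nonzero character_add r_distr\<close>)
      \<comment> \<open>The product \<open>?\<theta>\<close> is trivial only if \<psi> is the twist
        by \<open>\<ominus> r\<close>, which \<open>neg\<close> excludes.\<close>
      have "\<exists>a\<in>carrier R. ?\<theta> a \<noteq> 1"
      proof (rule ccontr)
        assume *: "\<not> (\<exists>a\<in>carrier R. ?\<theta> a \<noteq> 1)"
        have "\<psi> x = twist R \<chi> (\<ominus> r) x" for x
        proof (cases "x \<in> carrier R")
          case True
          have "\<psi> x * \<chi> (r \<otimes> x) = 1"
            using * True by auto
          then have "inverse (\<chi> (r \<otimes> x)) = \<psi> x"
            by (intro inverse_unique) (simp add: mult.commute)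
          then show ?thesis
            using True r by (simp add: twist_apply l_minus character_minus[OF character])
        next
          case False
          then show ?thesis
            using \<psi> by (auto simp: characters_def twist_def extensional_def)
        qed
        then have "\<psi> = twist R \<chi> (\<ominus> r)"
          by blast
        then show False
          using neg r by blast
      qed
      then obtain a where "a \<in> carrier R" "?\<theta> a \<noteq> 1"
        by blast
      from sum_nontrivial_character[OF \<theta> this] show ?thesis
        by simp
    qed
    have "0 = (\<Sum>r\<in>carrier R. \<Sum>x\<in>carrier R. \<psi> x * \<chi> (r \<otimes> x))"
      by (simp add: orth)
    also have "\<dots> = (\<Sum>x\<in>carrier R. \<psi> x * (\<Sum>r\<in>carrier R. \<chi> (r \<otimes> x)))"
      by (subst sum.swap) (simp add: sum_distrib_left)
    also have "\<dots> = (\<Sum>x\<in>carrier R. if x = \<zero> then of_nat (card (carrier R)) * \<psi> x else 0)"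
      by (rule sum.cong) (auto simp: sum_twist)
    also have "\<dots> = of_nat (card (carrier R))"
      using finite_carrier by (simp add: sum.delta character_zero[OF \<psi>])
    finally show False
      using finite_carrier zero_closed by auto
  qed
qed (use character in \<open>auto simp: twist_in_characters\<close>)

text \<open>The bijection \<open>twist R \<chi>\<close> carries the multiplication and the identity
  of the ring to those of the dual ring, so inverses correspond.\<close>

lemma Units_dual_ring: "Units (dual_ring R \<chi>) = twist R \<chi> ` Units R"
proof -
  have mult: "twist R \<chi> r \<otimes>\<^bsub>dual_ring R \<chi>\<^esub> twist R \<chi> s = twist R \<chi> (r \<otimes> s)"
    if "r \<in> carrier R" "s \<in> carrier R" for r s
    using that by (simp add: dual_ring_def the_inv_into_f_f inj_on_twist)
  have one: "\<one>\<^bsub>dual_ring R \<chi>\<^esub> = twist R \<chi> \<one>"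
    and carr: "carrier (dual_ring R \<chi>) = twist R \<chi> ` carrier R"
    by (simp_all add: dual_ring_def twist_image)
  have eq: "twist R \<chi> r \<otimes>\<^bsub>dual_ring R \<chi>\<^esub> twist R \<chi> s = \<one>\<^bsub>dual_ring R \<chi>\<^esub> \<longleftrightarrow> r \<otimes> s = \<one>"
    if "r \<in> carrier R" "s \<in> carrier R" for r s
    using that by (simp add: mult one inj_on_eq_iff[OF inj_on_twist])
  show ?thesis
  proof (intro equalityI subsetI)
    fix \<psi> assume "\<psi> \<in> Units (dual_ring R \<chi>)"
    then obtain r s where rs: "r \<in> carrier R" "s \<in> carrier R" "\<psi> = twist R \<chi> r"
        "twist R \<chi> s \<otimes>\<^bsub>dual_ring R \<chi>\<^esub> twist R \<chi> r = \<one>\<^bsub>dual_ring R \<chi>\<^esub>"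
      unfolding Units_def carr by auto
    have "s \<otimes> r = \<one>" "r \<otimes> s = \<one>"
      using rs eq[of s r] m_comm[of r s] by simp_all
    then have "r \<in> Units R"
      using rs unfolding Units_def by blast
    then show "\<psi> \<in> twist R \<chi> ` Units R"
      using rs(3) by blast
  next
    fix \<psi> assume "\<psi> \<in> twist R \<chi> ` Units R"
    then obtain r s where rs: "r \<in> carrier R" "s \<in> carrier R" "\<psi> = twist R \<chi> r"
        "s \<otimes> r = \<one>" "r \<otimes> s = \<one>"
      unfolding Units_def by auto
    then show "\<psi> \<in> Units (dual_ring R \<chi>)"
      unfolding Units_def carr using eq[of r s] eq[of s r] by auto
  qed
qed

text \<open>After interchanging the sums, the inner sum of
  \<open>\<chi> (r \<otimes> (x \<ominus> y))\<close> over \<open>r\<close> selects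
  \<open>x = y\<close> by \<open>sum_twist\<close>.\<close>

lemma fourier_inversion:
  assumes "y \<in> carrier R"
  shows "of_nat (card (carrier R)) * f y =
    (\<Sum>r\<in>carrier R. (\<Sum>x\<in>carrier R. f x * \<chi> (r \<otimes> x)) * inverse (\<chi> (r \<otimes> y)))"
proof -
  have "(\<Sum>r\<in>carrier R. (\<Sum>x\<in>carrier R. f x * \<chi> (r \<otimes> x)) * inverse (\<chi> (r \<otimes> y))) =
      (\<Sum>r\<in>carrier R. \<Sum>x\<in>carrier R. f x * \<chi> (r \<otimes> (x \<ominus> y)))"
  proof (rule sum.cong[OF refl], unfold sum_distrib_right, rule sum.cong[OF refl])
    fix r x assume "r \<in> carrier R" "x \<in> carrier R"
    moreover from this have "r \<otimes> (x \<ominus> y) = r \<otimes> x \<oplus> \<ominus> (r \<otimes> y)"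
      using assms by algebra
    ultimately show "f x * \<chi> (r \<otimes> x) * inverse (\<chi> (r \<otimes> y)) = f x * \<chi> (r \<otimes> (x \<ominus> y))"
      using assms by (simp add: character_add[OF character] character_minus[OF character])
  qed
  also have "\<dots> = (\<Sum>x\<in>carrier R. f x * (\<Sum>r\<in>carrier R. \<chi> (r \<otimes> (x \<ominus> y))))"
    by (subst sum.swap) (simp add: sum_distrib_left)
  also have "\<dots> = (\<Sum>x\<in>carrier R. if x = y then of_nat (card (carrier R)) * f x else 0)"
    by (rule sum.cong) (use assms in \<open>auto simp: sum_twist\<close>)
  also have "\<dots> = of_nat (card (carrier R)) * f y"
    using finite_carrier assms by (simp add: sum.delta)
  finally show ?thesis
    by simp
qed

end

subsection \<open>Functions supported on a pure orbit\<close>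

lemma mult_orbit_eq: "mult_orbit R K x = (\<lambda>k. k \<otimes>\<^bsub>R\<^esub> x) ` K"
  by (auto simp: mult_orbit_def orbit_def)

text \<open>The ideal \<open>I\<^sub>p\<close> of the outline. For a prime factor \<open>p\<close>
  of the order of a CG-ring it is the smallest non-zero ideal of the
  \<open>p\<close>-component.\<close>

definition p_torsion :: "('a, 'm) ring_scheme \<Rightarrow> nat \<Rightarrow> 'a set" where
  "p_torsion R p = {a \<in> carrier R. [p] \<cdot>\<^bsub>R\<^esub> a = \<zero>\<^bsub>R\<^esub>}"

text \<open>The element \<open>e p\<close> stands for the identity of the \<open>p\<close>-component; the dichotomy says that the
  \<open>p\<close>-component is local with radical generated by \<open>p\<close>.\<close>

locale galois_decomposition = cring R for R (structure) +
  fixes P :: "nat set" and e :: "nat \<Rightarrow> 'a"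
  assumes finite_carrier: "finite (carrier R)"
    and finite_P: "finite P"
    and prime_P: "p \<in> P \<Longrightarrow> Factorial_Ring.prime p"
    and e_closed: "p \<in> P \<Longrightarrow> e p \<in> carrier R"
    and e_nonzero: "p \<in> P \<Longrightarrow> e p \<noteq> \<zero>"
    and e_torsion: "p \<in> P \<Longrightarrow> \<exists>k::nat. add_pow R (p ^ k) (e p) = \<zero>"
    and e_orthogonal: "p \<in> P \<Longrightarrow> q \<in> P \<Longrightarrow> p \<noteq> q \<Longrightarrow> e p \<otimes> e q = \<zero>"
    and e_p_torsion: "p \<in> P \<Longrightarrow> a \<in> p_torsion R p \<Longrightarrow> e p \<otimes> a = a"
    and e_separating: "s \<in> carrier R \<Longrightarrow> (\<And>p. p \<in> P \<Longrightarrow> e p \<otimes> s = \<zero>) \<Longrightarrow> s = \<zero>"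
    and dichotomy: "p \<in> P \<Longrightarrow> r \<in> carrier R \<Longrightarrow>
      (\<exists>s\<in>carrier R. e p \<otimes> r = add_pow R p (e p \<otimes> s)) \<or> (\<exists>s\<in>carrier R. s \<otimes> r \<otimes> e p = e p)"
begin

section \<open>Torsion ideals and non-units\<close>

lemma p_torsion_closed: "a \<in> p_torsion R p \<Longrightarrow> a \<in> carrier R"
  by (simp add: p_torsion_def)

lemma p_torsion_mult: "a \<in> p_torsion R p \<Longrightarrow> r \<in> carrier R \<Longrightarrow> r \<otimes> a \<in> p_torsion R p"
  by (simp add: p_torsion_def flip: add_pow_rdistr)

lemma ideal_p_torsion: "ideal (p_torsion R p) R"
proof (rule idealI)
  show "subgroup (p_torsion R p) (add_monoid R)"
  proof (rule add.subgroupI)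
    show "\<ominus> a \<in> p_torsion R p" if "a \<in> p_torsion R p" for a
      using p_torsion_mult[OF that, of "\<ominus> \<one>"] that by (simp add: l_minus p_torsion_closed)
  qed (auto simp: p_torsion_def add.nat_pow_distrib)
  show "a \<otimes> x \<in> p_torsion R p" if "a \<in> p_torsion R p" "x \<in> carrier R" for a x
    using p_torsion_mult[OF that] that by (simp add: m_comm p_torsion_closed)
qed (auto simp: ring_axioms p_torsion_mult)

text \<open>Let \<open>k\<close> be least such that \<open>p ^ k\<close> kills \<open>e p\<close>.
  Since \<open>e p\<close> is non-zero, \<open>k\<close> is positive, and the multiple of
  \<open>e p\<close> by \<open>p ^ (k - 1)\<close> is the witness.\<close>

lemma p_torsion_nonzero:
  assumes "p \<in> P"
  obtains a where "a \<in> p_torsion R p" "a \<noteq> \<zero>"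
proof -
  define k where "k = (LEAST k::nat. add_pow R (p ^ k) (e p) = \<zero>)"
  have k: "add_pow R (p ^ k) (e p) = \<zero>"
    unfolding k_def using e_torsion[OF assms] by (rule LeastI_ex)
  then obtain j where j: "k = Suc j"
    using e_nonzero[OF assms] e_closed[OF assms] by (cases k) auto
  have "add_pow R (p ^ j) (e p) \<noteq> \<zero>"
    using not_less_Least[of j "\<lambda>k. add_pow R (p ^ k) (e p) = \<zero>"] j by (simp add: k_def)
  moreover have "add_pow R (p ^ j) (e p) \<in> p_torsion R p"
    using k e_closed[OF assms] by (simp add: p_torsion_def j add.nat_pow_pow mult.commute)
  ultimately show thesis
    using that by blast
qed

text \<open>In the first case of \<open>dichotomy\<close> the component of \<open>r\<close> is a
  multiple of \<open>p\<close> and therefore kills whatever \<open>p\<close> kills.\<close>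

lemma annihilates_p_torsion_or_invertible:
  assumes "p \<in> P" "r \<in> carrier R"
  shows "(\<forall>a\<in>p_torsion R p. r \<otimes> a = \<zero>) \<or> (\<exists>s\<in>carrier R. s \<otimes> r \<otimes> e p = e p)"
proof -
  have "r \<otimes> a = \<zero>" if s: "s \<in> carrier R" "e p \<otimes> r = add_pow R p (e p \<otimes> s)"
    and a: "a \<in> p_torsion R p" for s a
  proof -
    have "r \<otimes> a = r \<otimes> (e p \<otimes> a)"
      using e_p_torsion[OF assms(1) a] by simp
    also have "\<dots> = e p \<otimes> r \<otimes> a"
      using assms e_closed[OF assms(1)] p_torsion_closed[OF a] by (simp add: m_ac)
    also have "\<dots> = e p \<otimes> s \<otimes> (add_pow R p a)"
      using s(1) e_closed[OF assms(1)] p_torsion_closed[OF a]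
      by (simp add: s(2) add_pow_ldistr add_pow_rdistr)
    also have "\<dots> = \<zero>"
      using a s(1) e_closed[OF assms(1)] by (simp add: p_torsion_def)
    finally show ?thesis .
  qed
  then show ?thesis
    using dichotomy[OF assms] by blast
qed

text \<open>By finiteness a non-unit \<open>r\<close> kills some non-zero difference
  \<open>u \<ominus> v\<close>. At a prime \<open>p\<close> where this difference has a non-zero
  component, \<open>r\<close> cannot be invertible, so the other alternative holds.\<close>

lemma nonunit_annihilates_p_torsion:
  assumes r: "r \<in> carrier R" "r \<notin> Units R"
  obtains p where "p \<in> P" "\<And>a. a \<in> p_torsion R p \<Longrightarrow> r \<otimes> a = \<zero>"
proof -
  have "\<not> inj_on (\<lambda>x. r \<otimes> x) (carrier R)"
  proof
    assume "inj_on (\<lambda>x. r \<otimes> x) (carrier R)"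
    then have "(\<lambda>x. r \<otimes> x) ` carrier R = carrier R"
      using r finite_carrier by (intro endo_inj_surj) auto
    then obtain x where "x \<in> carrier R" "r \<otimes> x = \<one>"
      using one_closed by (metis imageE)
    then show False
      using r m_comm[of r x] unfolding Units_def by auto
  qed
  then obtain u v where uv: "u \<in> carrier R" "v \<in> carrier R" "r \<otimes> u = r \<otimes> v" "u \<noteq> v"
    unfolding inj_on_def by blast
  have "r \<otimes> (u \<ominus> v) = r \<otimes> u \<ominus> r \<otimes> v"
    using uv r by algebra
  then have c: "u \<ominus> v \<in> carrier R" "u \<ominus> v \<noteq> \<zero>" "r \<otimes> (u \<ominus> v) = \<zero>"
    using uv r by simp_all
  obtain p where p: "p \<in> P" "e p \<otimes> (u \<ominus> v) \<noteq> \<zero>"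
    using e_separating c by blast
  have "\<not> (\<exists>s\<in>carrier R. s \<otimes> r \<otimes> e p = e p)"
  proof
    assume "\<exists>s\<in>carrier R. s \<otimes> r \<otimes> e p = e p"
    then obtain s where s: "s \<in> carrier R" "s \<otimes> r \<otimes> e p = e p"
      by blast
    have "e p \<otimes> (u \<ominus> v) = s \<otimes> e p \<otimes> (r \<otimes> (u \<ominus> v))"
      using s(1) r c(1) e_closed[OF p(1)] by (subst s(2)[symmetric]) (simp add: m_ac)
    then show False
      using p c s e_closed by simp
  qed
  then show thesis
    using that annihilates_p_torsion_or_invertible[OF p(1) r(1)] p(1) by blast
qed

text \<open>Each \<open>a q\<close> equals \<open>e q \<otimes> a q\<close>, so orthogonality of
  \<open>e p\<close> and \<open>e q\<close> removes all terms but one.\<close>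

lemma e_finsum_p_torsion:
  assumes "a \<in> (\<Pi> p\<in>P. p_torsion R p)" "Q \<subseteq> P" "p \<in> Q"
  shows "e p \<otimes> (\<Oplus>q\<in>Q. a q) = a p"
proof -
  have Q: "finite Q" "p \<in> P"
    using assms finite_P finite_subset by auto
  have a: "a q \<in> carrier R" "e q \<otimes> a q = a q" if "q \<in> Q" for q
  proof -
    have "q \<in> P" "a q \<in> p_torsion R q"
      using that assms by auto
    then show "a q \<in> carrier R" "e q \<otimes> a q = a q"
      using p_torsion_closed e_p_torsion by auto
  qed
  have "e p \<otimes> (\<Oplus>q\<in>Q. a q) = (\<Oplus>q\<in>Q. e p \<otimes> a q)"
    using a Q e_closed by (intro finsum_rdistr) auto
  also have "\<dots> = (\<Oplus>q\<in>Q. if p = q then a q else \<zero>)"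
  proof (rule finsum_cong')
    show "e p \<otimes> a q = (if p = q then a q else \<zero>)" if "q \<in> Q" for q
    proof (cases "p = q")
      case False
      have "e p \<otimes> a q = e p \<otimes> (e q \<otimes> a q)"
        using a[OF that] by simp
      also have "\<dots> = e p \<otimes> e q \<otimes> a q"
        using a[OF that] e_closed Q that assms(2) by (intro m_assoc[symmetric]) auto
      finally have "e p \<otimes> a q = e p \<otimes> e q \<otimes> a q" .
      then show ?thesis
        using False that assms(2) Q a[OF that] by (auto simp: e_orthogonal)
    qed (use a that in simp)
  qed (use a in auto)
  also have "\<dots> = a p"
    using assms(3) Q a by (intro add.finprod_singleton) auto
  finally show ?thesis .
qed

section \<open>Leaving a pure orbit by torsion translations\<close>

lemma units_subgroupD:
  assumes "subgroup K (units_of R)"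
  shows "\<one> \<in> K" "k \<in> K \<Longrightarrow> k \<in> Units R" "k \<in> K \<Longrightarrow> k \<in> carrier R"
    "k \<in> K \<Longrightarrow> l \<in> K \<Longrightarrow> k \<otimes> l \<in> K" "k \<in> K \<Longrightarrow> inv k \<in> K"
  using subgroup.one_closed[OF assms] subgroup.mem_carrier[OF assms]
    subgroup.m_closed[OF assms] subgroup.m_inv_closed[OF assms]
  by (auto simp: units_of_carrier units_of_mult units_of_one units_of_inv)

text \<open>Purity gives a point \<open>k \<otimes> y\<close> of the orbit that some torsion element
  \<open>b\<close> moves out of it. Multiplication by \<open>inv k\<close> preserves the orbit and
  transports this to \<open>y\<close>, with \<open>inv k \<otimes> b\<close> in place of
  \<open>b\<close>.\<close>

lemma pure_orbit_leaves:
  assumes K: "subgroup K (units_of R)" and y: "y \<in> carrier R"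
    and pure: "pure R ((\<lambda>k. k \<otimes> y) ` K)" and p: "p \<in> P"
  obtains b where "b \<in> p_torsion R p" "y \<oplus> b \<notin> (\<lambda>k. k \<otimes> y) ` K"
proof -
  let ?X = "(\<lambda>k. k \<otimes> y) ` K"
  note KD = units_subgroupD[OF K]
  have X: "?X \<subseteq> carrier R"
    using KD y by auto
  have "?X <+> p_torsion R p \<noteq> ?X"
    using pure ideal_p_torsion p_torsion_nonzero[OF p] unfolding pure_def by (metis singletonD)
  moreover have "?X \<subseteq> ?X <+> p_torsion R p"
  proof
    fix z assume "z \<in> ?X"
    moreover have "\<zero> \<in> p_torsion R p"
      by (simp add: p_torsion_def)
    ultimately show "z \<in> ?X <+> p_torsion R p"
      using X unfolding set_add_def' by force
  qed
  ultimately obtain k b where kb: "k \<in> K" "b \<in> p_torsion R p" "k \<otimes> y \<oplus> b \<notin> ?X"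
    unfolding set_add_def' by blast
  have k: "k \<in> carrier R" "inv k \<in> carrier R" "k \<otimes> inv k = \<one>"
    using KD kb(1) by auto
  have "y \<oplus> inv k \<otimes> b \<notin> ?X"
  proof
    assume "y \<oplus> inv k \<otimes> b \<in> ?X"
    then obtain l where l: "l \<in> K" "y \<oplus> inv k \<otimes> b = l \<otimes> y"
      by blast
    have "k \<otimes> y \<oplus> b = k \<otimes> (y \<oplus> inv k \<otimes> b)"
      using k y kb(2) p_torsion_closed by (simp add: r_distr flip: m_assoc)
    also have "\<dots> = k \<otimes> l \<otimes> y"
      using k y l KD(3) by (simp add: m_assoc)
    finally show False
      using kb KD(4) l(1) by blast
  qed
  then show thesis
    using that p_torsion_mult[OF kb(2) k(2)] by blast
qed

text \<open>Because \<open>k\<close> fixes \<open>a\<close>, each further factor \<open>k\<close>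
  adds one more copy of \<open>a\<close>.\<close>

lemma unipotent_pow_mult:
  assumes "k \<in> carrier R" "y \<in> carrier R" "a \<in> carrier R" "k \<otimes> y = y \<oplus> a" "k \<otimes> a = a"
  shows "k [^] (m::nat) \<otimes> y = y \<oplus> add_pow R m a"
proof (induction m)
  case (Suc m)
  have "k [^] Suc m \<otimes> y = k [^] m \<otimes> (k \<otimes> y)"
    using assms by (simp add: m_assoc)
  also have "\<dots> = k [^] m \<otimes> y \<oplus> k [^] m \<otimes> a"
    using assms by (simp add: r_distr)
  also have "k [^] m \<otimes> a = a"
    using assms by (induction m) (simp_all add: m_assoc)
  finally show ?case
    using assms Suc by (simp add: a_assoc)
qed (use assms in simp)

lemma pow_mem_subgroup:
  assumes "subgroup K (units_of R)" "k \<in> K"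
  shows "k [^] (m::nat) \<in> K"
  using units_subgroupD[OF assms(1)] assms(2) by (induction m) auto

text \<open>The product of the other primes is invertible modulo \<open>p\<close>; its product with
  such an inverse is the required \<open>m\<close>.\<close>

lemma prime_selector:
  assumes "Q \<subseteq> P" "p \<in> Q"
  obtains m where "[m = 1] (mod p)" "\<And>q. q \<in> Q \<Longrightarrow> q \<noteq> p \<Longrightarrow> [m = 0] (mod q)"
proof -
  have Q: "finite Q"
    using assms finite_P finite_subset by auto
  have "coprime (\<Prod>(Q - {p})) p"
    using assms prime_P by (intro prod_coprime_left) (auto intro!: primes_coprime)
  then obtain u where "[\<Prod>(Q - {p}) * u = 1] (mod p)"
    using cong_solve_coprime_nat by fastforce
  moreover have "[\<Prod>(Q - {p}) * u = 0] (mod q)" if "q \<in> Q" "q \<noteq> p" for q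
    using that Q by (auto simp: cong_0_iff intro!: dvd_mult2 dvd_prodI)
  ultimately show thesis
    using that by blast
qed

lemma orbit_avoiding_family:
  assumes K: "subgroup K (units_of R)" and y: "y \<in> carrier R"
    and pure: "pure R ((\<lambda>k. k \<otimes> y) ` K)"
  shows "\<exists>a\<in>\<Pi> p\<in>P. p_torsion R p.
    \<forall>Q. Q \<subseteq> P \<longrightarrow> Q \<noteq> {} \<longrightarrow> y \<oplus> (\<Oplus>q\<in>Q. a q) \<notin> (\<lambda>k. k \<otimes> y) ` K"
proof -
  note KD = units_subgroupD[OF K]
  \<comment> \<open>The condition on \<open>a p\<close> involves \<open>p\<close> alone, so one
    family can serve all sets \<open>Q\<close> at once.\<close>
  let ?good = "\<lambda>p b. b \<in> p_torsion R p \<and>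
      (if e p \<otimes> y \<in> p_torsion R p then (e p \<otimes> y \<oplus> b = \<zero>) \<noteq> (e p \<otimes> y = \<zero>)
       else y \<oplus> b \<notin> (\<lambda>k. k \<otimes> y) ` K)"
  have "\<exists>b. ?good p b" if p: "p \<in> P" for p
  proof -
    have z: "e p \<otimes> y \<in> carrier R"
      using e_closed p y by simp
    \<comment> \<open>A zero component is moved by any non-zero torsion element, a non-zero torsion
      component is cancelled by its negative, and in the remaining case purity supplies
      \<open>b\<close>.\<close>
    consider "e p \<otimes> y = \<zero>" | "e p \<otimes> y \<noteq> \<zero>" "e p \<otimes> y \<in> p_torsion R p"
      | "e p \<otimes> y \<notin> p_torsion R p"
      by blast
    then show ?thesis
    proof cases
      case 1
      obtain b where b: "b \<in> p_torsion R p" "b \<noteq> \<zero>"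
        using p_torsion_nonzero[OF p] by blast
      have "\<zero> \<in> p_torsion R p" "b \<in> carrier R"
        using b(1) by (simp_all add: p_torsion_def)
      then show ?thesis
        using 1 b by (intro exI[of _ b]) simp
    next
      case 2
      have "\<ominus> (e p \<otimes> y) \<in> p_torsion R p"
        using p_torsion_mult[OF 2(2), of "\<ominus> \<one>"] z by (simp add: l_minus)
      then show ?thesis
        using 2 z by (intro exI[of _ "\<ominus> (e p \<otimes> y)"]) (simp add: r_neg)
    next
      case 3
      obtain b where "b \<in> p_torsion R p" "y \<oplus> b \<notin> (\<lambda>k. k \<otimes> y) ` K"
        using pure_orbit_leaves[OF K y pure p] by blast
      then show ?thesis
        using 3 by (intro exI[of _ b]) simp
    qed
  qed
  then obtain a where good: "\<And>p. p \<in> P \<Longrightarrow> ?good p (a p)"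
    by metis
  then have a: "a \<in> (\<Pi> p\<in>P. p_torsion R p)"
    by blast
  have "y \<oplus> (\<Oplus>q\<in>Q. a q) \<notin> (\<lambda>k. k \<otimes> y) ` K" if Q: "Q \<subseteq> P" "Q \<noteq> {}" for Q
  proof
    let ?s = "\<Oplus>q\<in>Q. a q"
    assume "y \<oplus> ?s \<in> (\<lambda>k. k \<otimes> y) ` K"
    then obtain k where k: "k \<in> K" "y \<oplus> ?s = k \<otimes> y"
      by blast
    have kc: "k \<in> carrier R" "k \<in> Units R"
      using k(1) KD by auto
    have aQ: "a \<in> Q \<rightarrow> carrier R" and finQ: "finite Q"
      using Q(1) a p_torsion_closed finite_subset[OF Q(1) finite_P] by auto
    have s: "?s \<in> carrier R"
      using aQ by (rule finsum_closed)
    \<comment> \<open>Multiplication by \<open>e q\<close> splits the equation for \<open>k\<close>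
      into its components.\<close>
    have comp: "e q \<otimes> y \<oplus> a q = k \<otimes> (e q \<otimes> y)" if q: "q \<in> Q" for q
    proof -
      have eq: "e q \<in> carrier R"
        using q Q e_closed by auto
      have "e q \<otimes> (y \<oplus> ?s) = e q \<otimes> y \<oplus> e q \<otimes> ?s"
        using y s eq by (rule r_distr)
      also have "e q \<otimes> ?s = a q"
        by (rule e_finsum_p_torsion[OF a Q(1) q])
      finally show ?thesis
        using eq y kc by (simp add: k(2) m_lcomm)
    qed
    show False
    proof (cases "\<exists>q\<in>Q. e q \<otimes> y \<in> p_torsion R q")
      case True
      then obtain q where q: "q \<in> Q" "e q \<otimes> y \<in> p_torsion R q"
        by blast
      have "e q \<otimes> y \<in> carrier R"
        using q Q e_closed y by auto
      \<comment> \<open>A unit preserves being zero or non-zero, while \<open>?good\<close> makes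
        exactly one of the two sides of \<open>comp\<close> comparable to the component
        zero.\<close>
      then have "k \<otimes> (e q \<otimes> y) = \<zero> \<longleftrightarrow> e q \<otimes> y = \<zero>"
        using kc by (metis Units_l_cancel r_null zero_closed)
      then show False
        using good[of q] q Q comp[OF q(1)] by auto
    next
      case False
      have t: "k \<ominus> \<one> \<in> carrier R"
        using kc by simp
      \<comment> \<open>Otherwise \<open>k \<ominus> \<one>\<close> has an inverse \<open>u\<close>
        on the component at \<open>q\<close>. By \<open>comp\<close> it maps
        \<open>e q \<otimes> y\<close> to \<open>a q\<close>, so \<open>e q \<otimes> y\<close>
        equals \<open>u \<otimes> a q\<close> and is torsion, contrary to the case.\<close>
      have ta: "(k \<ominus> \<one>) \<otimes> a q = \<zero>" if q: "q \<in> Q" for q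
      proof (rule ccontr)
        assume "(k \<ominus> \<one>) \<otimes> a q \<noteq> \<zero>"
        have qP: "q \<in> P" and aq: "a q \<in> p_torsion R q" and eq: "e q \<in> carrier R"
          using q Q a e_closed by auto
        obtain u where u: "u \<in> carrier R" "u \<otimes> (k \<ominus> \<one>) \<otimes> e q = e q"
          using annihilates_p_torsion_or_invertible[OF qP t] aq \<open>(k \<ominus> \<one>) \<otimes> a q \<noteq> \<zero>\<close> by blast
        have aqc: "a q \<in> carrier R"
          using aq by (rule p_torsion_closed)
        have "(k \<ominus> \<one>) \<otimes> (e q \<otimes> y) = k \<otimes> (e q \<otimes> y) \<ominus> e q \<otimes> y"
          using kc eq y by algebra
        also have "\<dots> = (e q \<otimes> y \<oplus> a q) \<ominus> e q \<otimes> y"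
          by (simp add: comp[OF q])
        also have "\<dots> = a q"
          using eq y aqc by algebra
        finally have "a q = (k \<ominus> \<one>) \<otimes> (e q \<otimes> y)"
          by simp
        then have "u \<otimes> a q = (u \<otimes> (k \<ominus> \<one>) \<otimes> e q) \<otimes> y"
          using u(1) t eq y by (simp add: m_assoc)
        then have "e q \<otimes> y \<in> p_torsion R q"
          using p_torsion_mult[OF aq u(1)] u(2) by simp
        then show False
          using False q by blast
      qed
      have ka: "k \<otimes> a q = a q" if q: "q \<in> Q" for q
      proof -
        have aqc: "a q \<in> carrier R"
          using q aQ by auto
        have "k \<otimes> a q = (k \<ominus> \<one>) \<otimes> a q \<oplus> a q"
          using aqc kc by algebra
        then show ?thesis
          using aqc by (simp add: ta[OF q])
      qed
      have "k \<otimes> ?s = (\<Oplus>q\<in>Q. k \<otimes> a q)"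
        using aQ finQ kc by (intro finsum_rdistr)
      also have "\<dots> = ?s"
        using aQ by (intro finsum_cong') (auto simp: ka)
      finally have pow: "k [^] m \<otimes> y = y \<oplus> add_pow R m ?s" for m :: nat
        using unipotent_pow_mult[OF kc(1) y s] k(2) by simp
      obtain p where p: "p \<in> Q"
        using Q by blast
      \<comment> \<open>With this exponent, \<open>k [^] m\<close> translates \<open>y\<close> by
        \<open>a p\<close> alone, which the choice of \<open>a p\<close> forbids.\<close>
      obtain m where m: "[m = 1] (mod p)" "\<And>q. q \<in> Q \<Longrightarrow> q \<noteq> p \<Longrightarrow> [m = 0] (mod q)"
        using prime_selector[OF Q(1) p] by blast
      have "add_pow R m ?s = (\<Oplus>q\<in>Q. add_pow R m (a q))"
        using finQ aQ
      proof (induction Q rule: finite_induct)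
        case (insert q Q)
        then have "a q \<in> carrier R" "(\<Oplus>q\<in>Q. a q) \<in> carrier R"
          "(\<lambda>q. add_pow R m (a q)) \<in> insert q Q \<rightarrow> carrier R"
          by (auto intro: finsum_closed)
        then show ?case
          using insert by (simp add: add.nat_pow_distrib Pi_def)
      qed simp
      also have "\<dots> = (\<Oplus>q\<in>Q. if p = q then a q else \<zero>)"
      proof (rule finsum_cong')
        show "add_pow R m (a q) = (if p = q then a q else \<zero>)" if q: "q \<in> Q" for q
        proof -
          have "a q \<in> carrier R" "add_pow R q (a q) = \<zero>"
            using q Q a by (auto simp: p_torsion_def)
          from add_pow_cong[OF this] show ?thesis
            using m q \<open>a q \<in> carrier R\<close> by (cases "p = q") fastforce+
        qed
      qed (use aQ in auto)
      also have "\<dots> = a p"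
        using p finQ aQ by (intro add.finprod_singleton) auto
      finally have "y \<oplus> a p = k [^] m \<otimes> y"
        by (simp add: pow)
      then have "y \<oplus> a p \<in> (\<lambda>k. k \<otimes> y) ` K"
        using pow_mem_subgroup[OF K k(1)] by blast
      then show False
        using good[of p] False p Q by auto
    qed
  qed
  then show ?thesis
    using a by blast
qed

section \<open>Vanishing Fourier coefficients and alternating sums\<close>

text \<open>Fourier inversion reduces the claim to the contribution of each \<open>r\<close>. For a
  unit the coefficient is 0. For a non-unit the alternating sum over \<open>Q\<close> factors over
  the primes, and the factor at a prime whose torsion \<open>r\<close> kills is
  \<open>1 - 1\<close>.\<close>

lemma alternating_sum_eq_0:
  assumes "generating_character R \<chi>"
    and f: "\<And>r. r \<in> Units R \<Longrightarrow> (\<Sum>x\<in>carrier R. f x * \<chi> (r \<otimes> x)) = 0"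
    and a: "a \<in> (\<Pi> p\<in>P. p_torsion R p)" and y: "y \<in> carrier R"
  shows "(\<Sum>Q\<in>Pow P. (-1) ^ card Q * f (y \<oplus> (\<Oplus>q\<in>Q. a q))) = 0"
proof -
  interpret generating_character R \<chi> by fact
  define F where "F r = (\<Sum>x\<in>carrier R. f x * \<chi> (r \<otimes> x))" for r
  have aP: "a \<in> P \<rightarrow> carrier R"
    using a p_torsion_closed by auto
  have term_eq: "(\<Sum>Q\<in>Pow P. (-1) ^ card Q * (F r * inverse (\<chi> (r \<otimes> (y \<oplus> (\<Oplus>q\<in>Q. a q)))))) = 0"
    if r: "r \<in> carrier R" for r
  proof (cases "r \<in> Units R")
    case True
    then show ?thesis
      using f by (simp add: F_def)
  next
    case False
    then obtain p where p: "p \<in> P" "\<And>a. a \<in> p_torsion R p \<Longrightarrow> r \<otimes> a = \<zero>"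
      using nonunit_annihilates_p_torsion[OF r] by blast
    have split: "\<chi> (r \<otimes> (y \<oplus> (\<Oplus>q\<in>Q. a q))) = \<chi> (r \<otimes> y) * (\<Prod>q\<in>Q. \<chi> (r \<otimes> a q))"
      if "Q \<subseteq> P" for Q
    proof -
      have aQ: "a \<in> Q \<rightarrow> carrier R" and finQ: "finite Q"
        using that aP finite_P finite_subset by auto
      have "r \<otimes> (y \<oplus> (\<Oplus>q\<in>Q. a q)) = r \<otimes> y \<oplus> (\<Oplus>q\<in>Q. r \<otimes> a q)"
        using r y aQ finQ by (simp add: r_distr finsum_rdistr finsum_closed)
      moreover have "\<chi> (r \<otimes> y \<oplus> (\<Oplus>q\<in>Q. r \<otimes> a q)) =
          \<chi> (r \<otimes> y) * \<chi> (\<Oplus>q\<in>Q. r \<otimes> a q)"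
        using r y aQ by (intro character_add[OF character] finsum_closed) auto
      moreover have "\<chi> (\<Oplus>q\<in>Q. r \<otimes> a q) = (\<Prod>q\<in>Q. \<chi> (r \<otimes> a q))"
        using r aQ by (intro character_finsum[OF character finQ]) auto
      ultimately show ?thesis
        by simp
    qed
    \<comment> \<open>The product of ones over \<open>P - Q\<close> gives the terms the shape of a
      product of differences expanded over subsets.\<close>
    have "(\<Sum>Q\<in>Pow P. (-1) ^ card Q * (F r * inverse (\<chi> (r \<otimes> (y \<oplus> (\<Oplus>q\<in>Q. a q)))))) =
        (\<Sum>Q\<in>Pow P. F r * inverse (\<chi> (r \<otimes> y)) *
          ((-1) ^ card Q * (\<Prod>q\<in>Q. inverse (\<chi> (r \<otimes> a q))) * (\<Prod>q\<in>P - Q. 1)))"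
      by (rule sum.cong) (auto simp: split o_def simp flip: prod_inversef)
    also have "\<dots> = F r * inverse (\<chi> (r \<otimes> y)) * (\<Prod>q\<in>P. 1 - inverse (\<chi> (r \<otimes> a q)))"
      by (simp only: prod_diff_conv_sum[OF finite_P] sum_distrib_left)
    also have "(\<Prod>q\<in>P. 1 - inverse (\<chi> (r \<otimes> a q))) = 0"
    proof (rule prod_zero[OF finite_P])
      have "r \<otimes> a p = \<zero>"
        using p a by auto
      then show "\<exists>q\<in>P. 1 - inverse (\<chi> (r \<otimes> a q)) = 0"
        using p(1) by (intro bexI[of _ p]) (simp_all add: character_zero[OF character])
    qed
    finally show ?thesis
      by simp
  qed
  have "of_nat (card (carrier R)) * (\<Sum>Q\<in>Pow P. (-1) ^ card Q * f (y \<oplus> (\<Oplus>q\<in>Q. a q))) =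
      (\<Sum>Q\<in>Pow P. (-1) ^ card Q * (of_nat (card (carrier R)) * f (y \<oplus> (\<Oplus>q\<in>Q. a q))))"
    by (simp add: sum_distrib_left mult.left_commute)
  also have "\<dots> = (\<Sum>Q\<in>Pow P. \<Sum>r\<in>carrier R.
      (-1) ^ card Q * (F r * inverse (\<chi> (r \<otimes> (y \<oplus> (\<Oplus>q\<in>Q. a q))))))"
  proof (rule sum.cong[OF refl])
    fix Q assume "Q \<in> Pow P"
    then have "y \<oplus> (\<Oplus>q\<in>Q. a q) \<in> carrier R"
      using aP y by (intro a_closed finsum_closed) auto
    from fourier_inversion[OF this, of f]
    show "(-1) ^ card Q * (of_nat (card (carrier R)) * f (y \<oplus> (\<Oplus>q\<in>Q. a q))) =
        (\<Sum>r\<in>carrier R. (-1) ^ card Q * (F r * inverse (\<chi> (r \<otimes> (y \<oplus> (\<Oplus>q\<in>Q. a q))))))"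
      by (simp only: F_def sum_distrib_left)
  qed
  also have "\<dots> = 0"
    by (subst sum.swap) (simp add: term_eq)
  finally show ?thesis
    using finite_carrier zero_closed by auto
qed

lemma orbit_eq:
  assumes K: "subgroup K (units_of R)" and "x \<in> carrier R" "y \<in> (\<lambda>k. k \<otimes> x) ` K"
  shows "(\<lambda>k. k \<otimes> y) ` K = (\<lambda>k. k \<otimes> x) ` K"
proof -
  note KD = units_subgroupD[OF K]
  obtain k where k: "k \<in> K" "y = k \<otimes> x"
    using assms(3) by blast
  show ?thesis
  proof (intro equalityI subsetI)
    fix z assume "z \<in> (\<lambda>k. k \<otimes> y) ` K"
    then obtain l where "l \<in> K" "z = l \<otimes> y"
      by blast
    then have "z = l \<otimes> k \<otimes> x" "l \<otimes> k \<in> K"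
      using k KD assms(2) by (auto simp: m_assoc)
    then show "z \<in> (\<lambda>k. k \<otimes> x) ` K"
      by blast
  next
    fix z assume "z \<in> (\<lambda>k. k \<otimes> x) ` K"
    then obtain l where l: "l \<in> K" "z = l \<otimes> x"
      by blast
    have c: "k \<in> carrier R" "inv k \<in> carrier R" "l \<in> carrier R" "inv k \<otimes> k = \<one>"
      using k l KD by auto
    then have "z = l \<otimes> inv k \<otimes> y"
      using k(2) l(2) assms(2) by (simp add: m_assoc) (simp flip: m_assoc)
    moreover have "l \<otimes> inv k \<in> K"
      using k l KD by auto
    ultimately show "z \<in> (\<lambda>k. k \<otimes> y) ` K"
      by blast
  qed
qed

text \<open>At a point \<open>y\<close> of the support, an avoiding family makes every term with
  non-empty \<open>Q\<close> vanish, so the alternating sum, which is 0, equals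
  \<open>f y\<close>.\<close>

lemma eq_0_if_fourier_vanishes_on_Units:
  assumes \<chi>: "generating_character R \<chi>"
    and f: "\<And>r. r \<in> Units R \<Longrightarrow> (\<Sum>x\<in>carrier R. f x * \<chi> (r \<otimes> x)) = 0"
    and K: "subgroup K (units_of R)" and x: "x \<in> carrier R"
    and pure: "pure R (mult_orbit R K x)"
    and supp: "\<And>y. f y \<noteq> 0 \<Longrightarrow> y \<in> mult_orbit R K x"
  shows "f y = 0"
proof (rule ccontr)
  assume "f y \<noteq> 0"
  then have y: "y \<in> (\<lambda>k. k \<otimes> x) ` K"
    using supp by (simp add: mult_orbit_eq)
  then have yc: "y \<in> carrier R"
    using units_subgroupD[OF K] x by auto
  \<comment> \<open>The avoiding family is built around the base point of the orbit, so the base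
    point is moved to \<open>y\<close>.\<close>
  have X: "mult_orbit R K x = (\<lambda>k. k \<otimes> y) ` K"
    using orbit_eq[OF K x y] by (simp add: mult_orbit_eq)
  obtain a where a: "a \<in> (\<Pi> p\<in>P. p_torsion R p)"
    "\<forall>Q. Q \<subseteq> P \<longrightarrow> Q \<noteq> {} \<longrightarrow> y \<oplus> (\<Oplus>q\<in>Q. a q) \<notin> (\<lambda>k. k \<otimes> y) ` K"
    using orbit_avoiding_family[OF K yc pure[unfolded X]] by (elim bexE)
  have "0 = (\<Sum>Q\<in>Pow P. (-1) ^ card Q * f (y \<oplus> (\<Oplus>q\<in>Q. a q)))"
    by (rule alternating_sum_eq_0[OF \<chi> f a(1) yc, symmetric])
  also have "\<dots> = (\<Sum>Q\<in>Pow P. if Q = {} then f y else 0)"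
  proof (rule sum.cong[OF refl])
    fix Q assume "Q \<in> Pow P"
    then have "y \<oplus> (\<Oplus>q\<in>Q. a q) \<notin> mult_orbit R K x" if "Q \<noteq> {}"
      using a(2) that by (simp add: X)
    then have "f (y \<oplus> (\<Oplus>q\<in>Q. a q)) = 0" if "Q \<noteq> {}"
      using supp[of "y \<oplus> (\<Oplus>q\<in>Q. a q)"] that by argo
    then show "(-1) ^ card Q * f (y \<oplus> (\<Oplus>q\<in>Q. a q)) = (if Q = {} then f y else 0)"
      using yc by simp
  qed
  also have "\<dots> = f y"
    using finite_P by simp
  finally show False
    using \<open>f y \<noteq> 0\<close> by simp
qed

end

subsection \<open>Galois rings and CG-rings\<close>

text \<open>By finiteness there is a maximal member among the ideals that contain \<open>r\<close>
  but not 1; the principal ideal of \<open>r\<close> is one of them.\<close>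

lemma (in cring) nonunit_in_maximalideal:
  assumes fin: "finite (carrier R)" and r: "r \<in> carrier R" "r \<notin> Units R"
  obtains M where "maximalideal M R" "r \<in> M"
proof -
  let ?F = "{I. ideal I R \<and> r \<in> I \<and> \<one> \<notin> I}"
  have "?F \<subseteq> Pow (carrier R)"
    by (auto dest: ideal.Icarr)
  then have finF: "finite ?F"
    using fin finite_subset by blast
  have "\<one> \<notin> PIdl r"
  proof
    assume "\<one> \<in> PIdl r"
    then obtain x where "x \<in> carrier R" "x \<otimes> r = \<one>"
      unfolding cgenideal_def by auto
    then have "r \<in> Units R"
      using r(1) m_comm[of r x] unfolding Units_def by auto
    then show False
      using r(2) by contradiction
  qed
  then have "PIdl r \<in> ?F"
    using r(1) cgenideal_ideal cgenideal_self by blast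
  from finite_has_maximal2[OF finF this]
  obtain M where M: "M \<in> ?F" "\<forall>J\<in>?F. M \<subseteq> J \<longrightarrow> M = J"
    by blast
  have "maximalideal M R"
  proof (rule maximalidealI)
    show "ideal M R" "carrier R \<noteq> M"
      using M(1) by auto
    show "J = M \<or> J = carrier R" if J: "ideal J R" "M \<subseteq> J" "J \<subseteq> carrier R" for J
      using M J ideal.one_imp_carrier[OF J(1)] by blast
  qed
  then show thesis
    using that M(1) by blast
qed

text \<open>A non-unit lies in the only maximal ideal, which is the radical and hence consists of
  the multiples of \<open>p\<close>.\<close>

lemma galois_ring_nonunit:
  assumes A: "galois_ring p A" and r: "r \<in> carrier A" "r \<notin> Units A"
  obtains s where "s \<in> carrier A" "r = add_pow A p s"
proof -
  interpret cring A
    using A by (simp add: galois_ring_def local_cring_def)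
  obtain M where M: "maximalideal M A" "r \<in> M"
    using nonunit_in_maximalideal[OF _ r] A unfolding galois_ring_def by blast
  have "\<exists>!M. maximalideal M A"
    using A by (simp add: galois_ring_def local_cring_def)
  then have "{M. maximalideal M A} = {M}"
    using M(1) by blast
  then have "r \<in> radical A"
    using M(2) r(1) by (simp add: radical_def)
  then show thesis
    using A that unfolding galois_ring_def by blast
qed

lemma galois_ring_one_neq_zero:
  assumes "galois_ring p A"
  shows "\<one>\<^bsub>A\<^esub> \<noteq> \<zero>\<^bsub>A\<^esub>"
proof
  interpret cring A
    using assms by (simp add: galois_ring_def local_cring_def)
  assume "\<one>\<^bsub>A\<^esub> = \<zero>\<^bsub>A\<^esub>"
  obtain M where "maximalideal M A"
    using assms unfolding galois_ring_def local_cring_def by blast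
  then interpret M: maximalideal M A .
  have "\<one>\<^bsub>A\<^esub> \<in> M"
    using M.zero_closed \<open>\<one>\<^bsub>A\<^esub> = \<zero>\<^bsub>A\<^esub>\<close> by simp
  then show False
    using M.one_imp_carrier M.I_notcarr by simp
qed

text \<open>Divide \<open>x\<close> by \<open>p\<close> as often as possible: the last quotient is a
  unit, since a non-unit could be divided once more. The exponents in \<open>S\<close> stay below
  \<open>N\<close> because \<open>p ^ N\<close> kills the ring and \<open>x\<close> is
  non-zero.\<close>

lemma galois_ring_element_form:
  assumes A: "galois_ring p A" and N: "add_pow A ((p::nat) ^ N) \<one>\<^bsub>A\<^esub> = \<zero>\<^bsub>A\<^esub>"
    and x: "x \<in> carrier A" "x \<noteq> \<zero>\<^bsub>A\<^esub>"
  obtains j u where "u \<in> Units A" "x = add_pow A (p ^ j) u"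
proof -
  interpret cring A
    using A by (simp add: galois_ring_def local_cring_def)
  define S where "S = {j. \<exists>u\<in>carrier A. x = add_pow A (p ^ j) u}"
  have S_less: "j < N" if j: "j \<in> S" for j
  proof (rule ccontr)
    assume "\<not> j < N"
    obtain u where u: "u \<in> carrier A" "x = add_pow A (p ^ j) u"
      using j unfolding S_def by blast
    have "add_pow A (p ^ N) u = u \<otimes>\<^bsub>A\<^esub> add_pow A (p ^ N) \<one>\<^bsub>A\<^esub>"
      using u(1) by (simp add: add_pow_rdistr)
    then have "add_pow A (p ^ N) u = \<zero>\<^bsub>A\<^esub>"
      using u(1) N by simp
    moreover have "p ^ j = p ^ N * p ^ (j - N)"
      using \<open>\<not> j < N\<close> by (simp flip: power_add)
    then have "x = add_pow A (p ^ (j - N)) (add_pow A (p ^ N) u)"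
      using u by (simp add: add.nat_pow_pow)
    ultimately show False
      using x(2) by simp
  qed
  have "S \<subseteq> {..<N}"
    using S_less by auto
  then have finS: "finite S"
    using finite_subset by blast
  have "0 \<in> S"
    using x(1) by (auto simp: S_def)
  then have "S \<noteq> {}"
    by blast
  with finS have "Max S \<in> S"
    by (rule Max_in)
  have "Suc (Max S) \<notin> S"
    using Max_ge[OF finS, of "Suc (Max S)"] by auto
  from \<open>Max S \<in> S\<close> obtain u where u: "u \<in> carrier A" "x = add_pow A (p ^ Max S) u"
    unfolding S_def by blast
  have "u \<in> Units A"
  proof (rule ccontr)
    assume "u \<notin> Units A"
    then obtain s where s: "s \<in> carrier A" "u = add_pow A p s"
      using galois_ring_nonunit[OF A u(1)] by blast
    then have "x = add_pow A (p ^ Suc (Max S)) s"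
      using u by (simp add: add.nat_pow_pow)
    then show False
      using \<open>Suc (Max S) \<notin> S\<close> s(1) by (auto simp: S_def)
  qed
  then show thesis
    using that u by blast
qed

lemma primitive_root_of_unity_dvd:
  assumes z: "primitive_root_of_unity n z" and "n > 0" "z ^ m = 1"
  shows "n dvd m"
proof -
  have "z ^ m = (z ^ n) ^ (m div n) * z ^ (m mod n)"
    by (simp flip: power_mult power_add)
  then have "z ^ (m mod n) = 1"
    using assms by (simp add: primitive_root_of_unity_def)
  moreover have "z ^ k \<noteq> 1" if "0 < k" "k < n" for k
    using z that by (simp add: primitive_root_of_unity_def)
  ultimately have "m mod n = 0"
    using mod_less_divisor[OF \<open>n > 0\<close>, of m] by (meson gr0I)
  then show ?thesis
    by auto
qed

text \<open>A non-zero \<open>x\<close> is a unit times \<open>p ^ j\<close>, so all multiples by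
  \<open>p ^ j\<close> lie in the ideal of \<open>x\<close>, where \<psi> is trivial. Hence
  \<open>z ^ (p ^ j) = 1\<close>, the characteristic divides \<open>p ^ j\<close>, and
  \<open>x\<close> is 0 after all.\<close>

lemma galois_ring_generating:
  assumes A: "galois_ring p A" and p: "Factorial_Ring.prime p"
    and N: "add_pow A (p ^ N) \<one>\<^bsub>A\<^esub> = \<zero>\<^bsub>A\<^esub>"
    and \<psi>: "\<psi> \<in> characters (add_monoid A)"
    and z: "z \<in> \<psi> ` carrier A" "primitive_root_of_unity (characteristic A) z"
    and x: "x \<in> carrier A" "\<And>r. r \<in> carrier A \<Longrightarrow> \<psi> (r \<otimes>\<^bsub>A\<^esub> x) = 1"
  shows "x = \<zero>\<^bsub>A\<^esub>"
proof (rule ccontr)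
  interpret cring A
    using A by (simp add: galois_ring_def local_cring_def)
  assume "x \<noteq> \<zero>\<^bsub>A\<^esub>"
  then obtain j u where u: "u \<in> Units A" "x = add_pow A (p ^ j) u"
    using galois_ring_element_form[OF A N x(1)] by blast
  obtain a where a: "a \<in> carrier A" "z = \<psi> a"
    using z(1) by blast
  have uc: "u \<in> carrier A" "inv\<^bsub>A\<^esub> u \<in> carrier A" "inv\<^bsub>A\<^esub> u \<otimes>\<^bsub>A\<^esub> u = \<one>\<^bsub>A\<^esub>"
    using u(1) by auto
  have "z ^ (p ^ j) = \<psi> (add_pow A (p ^ j) a)"
    using a by (simp add: character_add_pow[OF \<psi>])
  also have "add_pow A (p ^ j) a = (a \<otimes>\<^bsub>A\<^esub> inv\<^bsub>A\<^esub> u) \<otimes>\<^bsub>A\<^esub> x"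
    using a uc by (simp add: u(2) add_pow_rdistr m_assoc)
  also have "\<psi> \<dots> = 1"
    using a uc by (intro x(2)) simp
  finally have z1: "z ^ (p ^ j) = 1" .
  have "p ^ N > 0 \<and> add_pow A (p ^ N) \<one>\<^bsub>A\<^esub> = \<zero>\<^bsub>A\<^esub>"
    using N p prime_gt_0_nat by simp
  \<comment> \<open>The number \<open>p ^ N\<close> shows that the minimum defining the
    characteristic exists.\<close>
  then have c: "characteristic A > 0" "add_pow A (characteristic A) \<one>\<^bsub>A\<^esub> = \<zero>\<^bsub>A\<^esub>"
    unfolding characteristic_def
    using LeastI[of "\<lambda>n. n > 0 \<and> add_pow A n \<one>\<^bsub>A\<^esub> = \<zero>\<^bsub>A\<^esub>" "p ^ N"] by blast+
  then obtain m where "p ^ j = characteristic A * m"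
    using primitive_root_of_unity_dvd[OF z(2) _ z1] by blast
  then have "add_pow A (p ^ j) \<one>\<^bsub>A\<^esub> = add_pow A m (add_pow A (characteristic A) \<one>\<^bsub>A\<^esub>)"
    by (simp add: add.nat_pow_pow)
  then have "add_pow A (p ^ j) \<one>\<^bsub>A\<^esub> = \<zero>\<^bsub>A\<^esub>"
    using c by simp
  moreover have "x = u \<otimes>\<^bsub>A\<^esub> add_pow A (p ^ j) \<one>\<^bsub>A\<^esub>"
    using uc by (simp add: u(2) add_pow_rdistr)
  ultimately show False
    using uc \<open>x \<noteq> \<zero>\<^bsub>A\<^esub>\<close> by simp
qed

section \<open>Primary components\<close>

lemma p_component_simps:
  "carrier (p_component R p) = p_part R p"
  "a \<otimes>\<^bsub>p_component R p\<^esub> b = a \<otimes>\<^bsub>R\<^esub> b"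
  "a \<oplus>\<^bsub>p_component R p\<^esub> b = a \<oplus>\<^bsub>R\<^esub> b"
  "\<zero>\<^bsub>p_component R p\<^esub> = \<zero>\<^bsub>R\<^esub>"
  "add_pow (p_component R p) (n::nat) x = add_pow R n x"
  by (simp_all add: p_component_def add_pow_def nat_pow_def)

context cring
begin

lemma p_part_closed: "x \<in> p_part R p \<Longrightarrow> x \<in> carrier R"
  by (simp add: p_part_def)

lemma p_part_mult:
  assumes "x \<in> p_part R p" "r \<in> carrier R"
  shows "r \<otimes> x \<in> p_part R p"
proof -
  obtain k :: nat where k: "x \<in> carrier R" "add_pow R (p ^ k) x = \<zero>"
    using assms(1) unfolding p_part_def by blast
  then have "add_pow R (p ^ k) (r \<otimes> x) = \<zero>"
    using assms(2) by (simp flip: add_pow_rdistr)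
  then show ?thesis
    using k(1) assms(2) unfolding p_part_def by blast
qed

lemma p_torsion_subset_p_part: "p_torsion R p \<subseteq> p_part R p"
  unfolding p_torsion_def p_part_def by (auto intro: exI[of _ 1])

text \<open>The ring axioms of the component supply these facts, without evaluating the definite
  description that defines its identity.\<close>

lemma p_component_one:
  assumes "cring (p_component R p)"
  shows "\<one>\<^bsub>p_component R p\<^esub> \<in> p_part R p"
    and "\<one>\<^bsub>p_component R p\<^esub> \<in> carrier R"
    and "x \<in> p_part R p \<Longrightarrow> \<one>\<^bsub>p_component R p\<^esub> \<otimes> x = x"
proof -
  interpret A: cring "p_component R p" by fact
  show one: "\<one>\<^bsub>p_component R p\<^esub> \<in> p_part R p"
    using A.one_closed by (simp add: p_component_simps)
  then show "\<one>\<^bsub>p_component R p\<^esub> \<in> carrier R"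
    by (rule p_part_closed)
  show "\<one>\<^bsub>p_component R p\<^esub> \<otimes> x = x" if "x \<in> p_part R p"
    using A.l_one[of x] that by (simp add: p_component_simps)
qed

text \<open>Coprime prime powers both kill \<open>x\<close>; some multiple of the first is 1 modulo
  the second.\<close>

lemma p_part_Int_eq_zero:
  assumes "Factorial_Ring.prime p" "Factorial_Ring.prime q" "p \<noteq> q"
    and x: "x \<in> p_part R p" "x \<in> p_part R q"
  shows "x = \<zero>"
proof -
  obtain k l :: nat where kl: "add_pow R (p ^ k) x = \<zero>" "add_pow R (q ^ l) x = \<zero>"
    and xc: "x \<in> carrier R"
    using x unfolding p_part_def by blast
  have "coprime (p ^ k) (q ^ l)"
    using assms(1-3) by (simp add: primes_coprime)
  then obtain u where "[p ^ k * u = 1] (mod q ^ l)"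
    using cong_solve_coprime_nat by (metis One_nat_def)
  then have "add_pow R (p ^ k * u) x = add_pow R (1::nat) x"
    by (rule add_pow_cong[OF xc kl(2)])
  moreover have "add_pow R (p ^ k * u) x = add_pow R u (add_pow R (p ^ k) x)"
    using xc by (simp add: add.nat_pow_pow)
  ultimately show ?thesis
    using xc kl(1) by simp
qed

text \<open>Descent on divisors \<open>m\<close> of the order that kill \<open>s\<close>, from the
  order itself down to 1. If \<open>m = p * m'\<close>, then the multiple of \<open>s\<close> by
  \<open>m'\<close> is \<open>p\<close>-torsion and so fixed by the identity of the
  \<open>p\<close>-component, which kills \<open>s\<close>; thus \<open>m'\<close> kills
  \<open>s\<close> too.\<close>

lemma components_separate:
  assumes fin: "finite (carrier R)"
    and comp: "\<And>p. p \<in> prime_factors (order R) \<Longrightarrow> cring (p_component R p)"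
    and s: "s \<in> carrier R"
      "\<And>p. p \<in> prime_factors (order R) \<Longrightarrow> \<one>\<^bsub>p_component R p\<^esub> \<otimes> s = \<zero>"
  shows "s = \<zero>"
proof -
  have ord: "order R > 0"
    using fin zero_closed by (auto simp: order_def card_gt_0_iff)
  have killed: "s = \<zero>" if "m dvd order R" "add_pow R m s = \<zero>" for m :: nat
    using that
  proof (induction m rule: less_induct)
    case (less m)
    have m: "m > 0"
      using less.prems(1) ord by (auto intro: Nat.gr0I)
    show ?case
    proof (cases "m = 1")
      case True
      then show ?thesis
        using less.prems(2) s(1) by simp
    next
      case False
      then obtain p where p: "Factorial_Ring.prime p" "p dvd m"
        using prime_factor_nat by blast
      then obtain m' where m': "m = p * m'"
        by blast
      have pP: "p \<in> prime_factors (order R)"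
        using p less.prems(1) ord by (auto simp: prime_factors_dvd intro: dvd_trans)
      note one = p_component_one[OF comp[OF pP]]
      have "add_pow R p (add_pow R m' s) = \<zero>"
        using less.prems(2) s(1) by (simp add: m' add.nat_pow_pow mult.commute)
      then have "add_pow R m' s \<in> p_part R p"
        using p_torsion_subset_p_part[of p] s(1) by (auto simp: p_torsion_def)
      then have "add_pow R m' s = \<one>\<^bsub>p_component R p\<^esub> \<otimes> add_pow R m' s"
        using one(3) by simp
      also have "\<dots> = \<zero>"
        using one(2) s pP by (simp add: add_pow_rdistr)
      finally have "add_pow R m' s = \<zero>" .
      moreover have "m' < m"
        using m m' prime_gt_1_nat[OF p(1)] by simp
      moreover have "m' dvd order R"
        using less.prems(1) m' by (simp add: dvd_mult_right)
      ultimately show ?thesis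
        using less.IH by blast
    qed
  qed
  show ?thesis
    by (rule killed[OF dvd_refl]) (use add.pow_order_eq_1[of s] s(1) in \<open>simp add: order_def\<close>)
qed

end

section \<open>Decomposition and generating character of a CG-ring\<close>

lemma CG_ringD:
  assumes "CG_ring R"
  shows "cring R" "finite (carrier R)"
    and "p \<in> prime_factors (order R) \<Longrightarrow> galois_ring p (p_component R p)"
    and "p \<in> prime_factors (order R) \<Longrightarrow> cring (p_component R p)"
  using assms by (auto simp: CG_ring_def finite_cring_def galois_ring_def local_cring_def)

lemma CG_ring_decomposition:
  fixes R (structure)
  assumes "CG_ring R"
  shows "galois_decomposition R (prime_factors (order R)) (\<lambda>p. \<one>\<^bsub>p_component R p\<^esub>)"
proof -
  note RD = CG_ringD[OF assms]
  interpret cring R by (rule RD(1))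
  note one = p_component_one[OF RD(4)]
  show ?thesis
  proof (intro galois_decomposition.intro galois_decomposition_axioms.intro RD(1,2) finite_set_mset)
    fix p assume p: "p \<in> prime_factors (order R)"
    let ?e = "\<one>\<^bsub>p_component R p\<^esub>"
    show "Factorial_Ring.prime p"
      using p by (rule in_prime_factors_imp_prime)
    show "?e \<in> carrier R"
      by (rule one(2)[OF p])
    show "?e \<noteq> \<zero>"
      using galois_ring_one_neq_zero[OF RD(3)[OF p]] by (simp add: p_component_simps)
    show "\<exists>k::nat. add_pow R (p ^ k) ?e = \<zero>"
      using one(1)[OF p] by (simp add: p_part_def)
    show "?e \<otimes> a = a" if "a \<in> p_torsion R p" for a
      using one(3)[OF p] that p_torsion_subset_p_part by blast
    \<comment> \<open>The product lies in both components, which meet only in 0.\<close>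
    show "?e \<otimes> \<one>\<^bsub>p_component R q\<^esub> = \<zero>" if q: "q \<in> prime_factors (order R)" "p \<noteq> q" for q
    proof (rule p_part_Int_eq_zero)
      show "?e \<otimes> \<one>\<^bsub>p_component R q\<^esub> \<in> p_part R q"
        using p_part_mult one(1)[OF q(1)] one(2)[OF p] by blast
      show "?e \<otimes> \<one>\<^bsub>p_component R q\<^esub> \<in> p_part R p"
        using p_part_mult[OF one(1)[OF p] one(2)[OF q(1)]] one(2)[OF p] one(2)[OF q(1)]
        by (simp add: m_comm)
    qed (use p q in auto)
    show "(\<exists>s\<in>carrier R. ?e \<otimes> r = add_pow R p (?e \<otimes> s)) \<or> (\<exists>s\<in>carrier R. s \<otimes> r \<otimes> ?e = ?e)"
      if r: "r \<in> carrier R" for r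
    \<comment> \<open>A unit of the component gives the second alternative; a non-unit is a multiple
      of \<open>p\<close>, which is the first.\<close>
    proof (cases "?e \<otimes> r \<in> Units (p_component R p)")
      case True
      then obtain s where "s \<in> p_part R p" "s \<otimes> (?e \<otimes> r) = ?e"
        unfolding Units_def by (auto simp: p_component_simps)
      then have "s \<in> carrier R" "s \<otimes> r \<otimes> ?e = ?e"
        using r one(2)[OF p] p_part_closed[of s] by (auto simp: m_ac)
      then show ?thesis
        by blast
    next
      case False
      have "?e \<otimes> r \<in> p_part R p"
        using p_part_mult[OF one(1)[OF p] r] r one(2)[OF p] by (simp add: m_comm)
      then obtain s where "s \<in> p_part R p" "?e \<otimes> r = add_pow R p s"
        using galois_ring_nonunit[OF RD(3)[OF p] _ False] by (auto simp: p_component_simps)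
      then show ?thesis
        using one(3)[OF p] p_part_closed by metis
    qed
  qed (use components_separate[OF RD(2) RD(4)] in blast)
qed

text \<open>If the product character is trivial on the ideal of \<open>x\<close>, take
  \<open>r\<close> in the \<open>p\<close>-component. Then \<open>r \<otimes> x\<close> has zero
  projection to every other component, so only the factor \<open>\<phi> p\<close> remains, and the
  result for Galois rings shows that the \<open>p\<close>-component of \<open>x\<close> is
  0.\<close>

lemma product_character_generating:
  fixes R (structure)
  assumes R: "CG_ring R" and \<phi>: "admissible_family R \<phi>"
  shows "generating_character R (product_character R \<phi>)"
proof -
  note RD = CG_ringD[OF R]
  interpret galois_decomposition R "prime_factors (order R)" "\<lambda>p. \<one>\<^bsub>p_component R p\<^esub>"
    by (rule CG_ring_decomposition[OF R])
  note one = p_component_one[OF RD(4)]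
  let ?e = "\<lambda>p. \<one>\<^bsub>p_component R p\<^esub>" and ?\<chi> = "product_character R \<phi>"
  have \<phi>c: "\<phi> p \<in> characters (add_monoid (p_component R p))" if "p \<in> prime_factors (order R)" for p
    using \<phi> that by (simp add: admissible_family_def)
  have \<phi>_add: "\<phi> p (x \<oplus> y) = \<phi> p x * \<phi> p y" and \<phi>_nonzero: "\<phi> p x \<noteq> 0"
    if "p \<in> prime_factors (order R)" "x \<in> p_part R p" "y \<in> p_part R p" for p x y
    using ring.character_add[OF cring.axioms(1)[OF RD(4)] \<phi>c]
      ring.character_nonzero[OF cring.axioms(1)[OF RD(4)] \<phi>c] that
    by (simp_all add: p_component_simps)
  have \<phi>_zero: "\<phi> p \<zero> = 1" if "p \<in> prime_factors (order R)" for p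
    using ring.character_zero[OF cring.axioms(1)[OF RD(4)] \<phi>c] that by (simp add: p_component_simps)
  have ex: "?e p \<otimes> x \<in> p_part R p" if "p \<in> prime_factors (order R)" "x \<in> carrier R" for p x
    using p_part_mult[OF one(1) that(2)] that one(2) by (simp add: m_comm)
  have char: "?\<chi> \<in> characters (add_monoid R)"
  proof (rule charactersI)
    show "?\<chi> x \<noteq> 0" if "x \<in> carrier R" for x
      using that \<phi>_nonzero[OF _ ex ex] by (simp add: product_character_def)
    show "?\<chi> (x \<oplus> y) = ?\<chi> x * ?\<chi> y" if "x \<in> carrier R" "y \<in> carrier R" for x y
    proof -
      have "\<phi> p (?e p \<otimes> (x \<oplus> y)) = \<phi> p (?e p \<otimes> x) * \<phi> p (?e p \<otimes> y)"
        if "p \<in> prime_factors (order R)" for p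
        using that \<open>x \<in> carrier R\<close> \<open>y \<in> carrier R\<close> \<phi>_add[OF that ex ex] one(2)[OF that]
        by (simp add: r_distr)
      then show ?thesis
        using that by (simp add: product_character_def flip: prod.distrib)
    qed
  qed (simp add: product_character_def)
  show ?thesis
  proof (intro generating_character.intro generating_character_axioms.intro RD(1,2) char)
    fix x assume x: "x \<in> carrier R" "\<And>r. r \<in> carrier R \<Longrightarrow> ?\<chi> (r \<otimes> x) = 1"
    show "x = \<zero>"
    proof (rule e_separating[OF x(1)])
      fix p assume p: "p \<in> prime_factors (order R)"
      obtain N :: nat where N: "add_pow R (p ^ N) (?e p) = \<zero>"
        using e_torsion[OF p] by blast
      obtain z where z: "z \<in> \<phi> p ` carrier (p_component R p)"
          "primitive_root_of_unity (characteristic (p_component R p)) z"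
        using \<phi> p unfolding admissible_family_def by blast
      have "?e p \<otimes> x = \<zero>\<^bsub>p_component R p\<^esub>"
      proof (rule galois_ring_generating[OF RD(3)[OF p] prime_P[OF p] _ \<phi>c[OF p] z])
        show "add_pow (p_component R p) (p ^ N) (?e p) = \<zero>\<^bsub>p_component R p\<^esub>"
          using N by (simp add: p_component_simps)
        show "?e p \<otimes> x \<in> carrier (p_component R p)"
          using ex[OF p x(1)] by (simp add: p_component_simps)
        fix r assume "r \<in> carrier (p_component R p)"
        then have r: "r \<in> p_part R p" "r \<in> carrier R"
          by (simp_all add: p_component_simps p_part_closed)
        have rx: "r \<otimes> x \<in> p_part R p" "r \<otimes> x \<in> carrier R"
          using p_part_mult[OF r(1) x(1)] r x(1) by (simp_all add: m_comm)
        have "1 = ?\<chi> (r \<otimes> x)"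
          using x(2)[OF r(2)] by simp
        also have "\<dots> = (\<Prod>q\<in>prime_factors (order R). \<phi> q (?e q \<otimes> (r \<otimes> x)))"
          using rx by (simp add: product_character_def)
        also have "\<dots> = (\<Prod>q\<in>prime_factors (order R). if p = q then \<phi> p (r \<otimes> x) else 1)"
        proof (rule prod.cong[OF refl])
          fix q assume q: "q \<in> prime_factors (order R)"
          show "\<phi> q (?e q \<otimes> (r \<otimes> x)) = (if p = q then \<phi> p (r \<otimes> x) else 1)"
          proof (cases "p = q")
            case True
            then show ?thesis
              using one(3)[OF p rx(1)] by simp
          next
            case False
            have "?e q \<otimes> (r \<otimes> x) = \<zero>"
            proof (rule p_part_Int_eq_zero[OF prime_P[OF p] prime_P[OF q] False])
              show "?e q \<otimes> (r \<otimes> x) \<in> p_part R p"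
                by (rule p_part_mult[OF rx(1) one(2)[OF q]])
            qed (rule ex[OF q rx(2)])
            then show ?thesis
              using False \<phi>_zero[OF q] by simp
          qed
        qed
        also have "\<dots> = \<phi> p (r \<otimes> x)"
          using p by simp
        also have "r \<otimes> x = r \<otimes> (?e p \<otimes> x)"
          using one(3)[OF p r(1)] r x(1) one(2)[OF p] by (metis m_assoc m_comm)
        finally show "\<phi> p (r \<otimes>\<^bsub>p_component R p\<^esub> (?e p \<otimes> x)) = 1"
          by (simp add: p_component_simps)
      qed
      then show "?e p \<otimes> x = \<zero>"
        by (simp add: p_component_simps)
    qed
  qed
qed

section \<open>Separating subsets of a pure orbit by unit characters\<close>

theorem theorem4p2:
  fixes R :: "('a, 'm) ring_scheme"
    and \<phi> :: "nat \<Rightarrow> 'a \<Rightarrow> complex"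
    and K S S' :: "'a set"
    and x :: 'a
  assumes "CG_ring R"
    and "admissible_family R \<phi>"
    and "subgroup K (units_of R)"
    and "x \<in> carrier R"
    and "pure R (mult_orbit R K x)"
    and "S \<subseteq> mult_orbit R K x"
    and "S' \<subseteq> mult_orbit R K x"
    and "S \<noteq> S'"
    and "S \<noteq> {}"
  shows "(\<exists>\<chi>\<in>Units (dual_ring R (product_character R \<phi>)).
            char_sum \<chi> S \<noteq> char_sum \<chi> S') \<and>
         (\<forall>\<chi>\<in>Units (dual_ring R (product_character R \<phi>)).
            \<exists>r\<in>Units R. char_sum \<chi> (r <#\<^bsub>R\<^esub> S) \<noteq> 0)"
proof -
  define \<chi> where "\<chi> = product_character R \<phi>"
  interpret galois_decomposition R "prime_factors (order R)" "\<lambda>p. \<one>\<^bsub>p_component R p\<^esub>"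
    by (rule CG_ring_decomposition[OF assms(1)])
  interpret generating_character R \<chi>
    unfolding \<chi>_def by (rule product_character_generating[OF assms(1,2)])
  have X: "mult_orbit R K x \<subseteq> carrier R"
    using assms(4) units_subgroupD[OF assms(3)] by (auto simp: mult_orbit_eq)
  then have S: "S \<subseteq> carrier R" "S' \<subseteq> carrier R"
    using assms by auto
  \<comment> \<open>Character sums over \<open>T\<close> at twists are the Fourier coefficients of
    the indicator of \<open>T\<close>.\<close>
  have indicator: "(\<Sum>y\<in>carrier R. of_bool (y \<in> T) * \<chi> (r \<otimes>\<^bsub>R\<^esub> y)) = char_sum (twist R \<chi> r) T"
    if "T \<subseteq> carrier R" for T r
  proof -
    have "(\<Sum>y\<in>carrier R. of_bool (y \<in> T) * \<chi> (r \<otimes>\<^bsub>R\<^esub> y)) = (\<Sum>y\<in>T. \<chi> (r \<otimes>\<^bsub>R\<^esub> y))"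
      using that finite_carrier by (intro sum.mono_neutral_cong_right) auto
    then show ?thesis
      using that by (auto simp: char_sum_def twist_apply intro!: sum.cong)
  qed
  note vanish = eq_0_if_fourier_vanishes_on_Units[OF generating_character_axioms _ assms(3-5)]
  have "\<exists>\<psi>\<in>Units (dual_ring R \<chi>). char_sum \<psi> S \<noteq> char_sum \<psi> S'"
  proof (rule ccontr)
    assume "\<not> ?thesis"
    then have eq: "char_sum (twist R \<chi> r) S = char_sum (twist R \<chi> r) S'" if "r \<in> Units R" for r
      using that by (auto simp: Units_dual_ring)
    have "of_bool (y \<in> S) - of_bool (y \<in> S') = (0::complex)" for y
    proof (rule vanish[where f = "\<lambda>y. of_bool (y \<in> S) - of_bool (y \<in> S')"])
      show "(\<Sum>y\<in>carrier R. (of_bool (y \<in> S) - of_bool (y \<in> S')) * \<chi> (r \<otimes>\<^bsub>R\<^esub> y)) = 0"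
        if "r \<in> Units R" for r
        using eq[OF that] S by (simp add: left_diff_distrib sum_subtractf indicator)
    qed (use assms(6,7) in \<open>auto simp: of_bool_def split: if_splits\<close>)
    then have "y \<in> S \<longleftrightarrow> y \<in> S'" for y
      by (metis eq_iff_diff_eq_0 of_bool_eq_iff)
    then show False
      using assms(8) by blast
  qed
  moreover have "\<exists>r\<in>Units R. char_sum \<psi> (r <#\<^bsub>R\<^esub> S) \<noteq> 0" if \<psi>: "\<psi> \<in> Units (dual_ring R \<chi>)" for \<psi>
  proof (rule ccontr)
    assume *: "\<not> ?thesis"
    obtain u where u: "u \<in> Units R" "\<psi> = twist R \<chi> u"
      using \<psi> by (auto simp: Units_dual_ring)
    have zero: "char_sum (twist R \<chi> r) S = 0" if r: "r \<in> Units R" for r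
    proof -
      \<comment> \<open>Since \<psi> is the twist by \<open>u\<close>, its sum over \<open>S\<close>
        multiplied by this \<open>v\<close> is the sum of the twist by \<open>r\<close> over
        \<open>S\<close>. Unit multiples of \<open>S\<close> thus reach all Fourier coefficients at
        units.\<close>
      define v where "v = inv\<^bsub>R\<^esub> u \<otimes>\<^bsub>R\<^esub> r"
      have v: "v \<in> Units R" "u \<in> carrier R" "r \<in> carrier R" "v \<in> carrier R"
        using u(1) r by (auto simp: v_def)
      have uv: "u \<otimes>\<^bsub>R\<^esub> v = r"
        using u(1) r by (simp add: v_def Units_closed flip: m_assoc)
      have "inj_on (\<lambda>s. v \<otimes>\<^bsub>R\<^esub> s) S"
        using v(1) S(1) by (intro inj_onI) (meson Units_l_cancel subsetD)
      then have "char_sum \<psi> (v <#\<^bsub>R\<^esub> S) = (\<Sum>s\<in>S. \<psi> (v \<otimes>\<^bsub>R\<^esub> s))"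
        by (simp add: char_sum_def l_coset_def UNION_singleton_eq_range sum.reindex)
      also have "\<dots> = char_sum (twist R \<chi> r) S"
        unfolding char_sum_def
      proof (rule sum.cong[OF refl])
        fix s assume "s \<in> S"
        then have s: "s \<in> carrier R"
          using S by auto
        have "u \<otimes>\<^bsub>R\<^esub> (v \<otimes>\<^bsub>R\<^esub> s) = r \<otimes>\<^bsub>R\<^esub> s"
          using v s by (simp add: uv flip: m_assoc)
        then show "\<psi> (v \<otimes>\<^bsub>R\<^esub> s) = twist R \<chi> r s"
          using v(4) s by (simp add: u(2) twist_apply)
      qed
      finally show ?thesis
        using * v(1) by auto
    qed
    have "of_bool (y \<in> S) = (0::complex)" for y
    proof (rule vanish[where f = "\<lambda>y. of_bool (y \<in> S)"])
      show "(\<Sum>y\<in>carrier R. of_bool (y \<in> S) * \<chi> (r \<otimes>\<^bsub>R\<^esub> y)) = 0" if "r \<in> Units R" for r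
        using zero[OF that] S by (simp add: indicator)
    qed (use assms(6) in \<open>auto simp: of_bool_def split: if_splits\<close>)
    then show False
      using assms(9) by auto
  qed
  ultimately show ?thesis
    unfolding \<chi>_def by blast
qed

end
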